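(* Let $N$ be a non-negative integer and let $a$ be a complex number which is not a negative integer. If $x\in\mathbb{C}$ satisfies $\operatorname{Re} x<N+2$, then $$ {}_3F_2\!\left[\begin{matrix} a,\,a,\,x\\ 1+a,\,1+a+N\end{matrix};1\right] =\frac{a\,\Gamma(a+N+1)\,\Gamma(1-x)}{N!\,\Gamma(a-x+1)}\Big(\psi(a-x+1)-\psi(a)-\psi(N+1)-\gamma\Big) -\frac{a\,\Gamma(a+N+1)\,\Gamma(1-x)}{N!\,\Gamma(a-x+1)}\sum_{k=1}^{N}\frac{(a)_k\,(-N)_k}{k\cdot k!\,(a-x+1)_k}. $$ Here, at those $(a,x)$ in the stated range for which some term on the right-hand side is not defined (that is, $a=0$, or $x$ a positive integer, or $a-x+1$ a non-positive integer), the right-hand side is understood as its limiting value, i.e. as the value of the continuous extension in $(a,x)$ of the right-hand side from the points where all its terms are defined.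
   Context: $\Gamma$ denotes the (complex) gamma function, $\psi(z)=\Gamma'(z)/\Gamma(z)$ is the digamma function, and $\gamma$ is the Euler–Mascheroni constant. The Pochhammer symbol is $(\alpha)_0=1$ and $(\alpha)_k=\alpha(\alpha+1)\cdots(\alpha+k-1)$ for $k>0$. The hypergeometric series is $${}_rF_s\!\left[\begin{matrix} a_1,\dots,a_r\\ b_1,\dots,b_s\end{matrix};z\right]=\sum_{k=0}^{\infty}\frac{(a_1)_k\cdots(a_r)_k}{k!\,(b_1)_k\cdots(b_s)_k}z^k.$$ An empty sum (the case $N=0$) equals $0$. *)

theory Defs
  imports "HOL-Analysis.Analysis"
begin

text \<open>The library's \<^const>\<open>fps_hypergeo\<close> is the formal series whose \<open>k\<close>-th coefficient is
  \<open>(a\<^sub>1)\<^sub>k \<dots> (a\<^sub>r)\<^sub>k c\<^sup>k / (k! (b\<^sub>1)\<^sub>k \<dots> (b\<^sub>s)\<^sub>k)\<close>. Since \<^const>\<open>eval_fps\<close> is a plain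
  \<^const>\<open>suminf\<close>, it also sums the series on the boundary of its disc of convergence,
  but it has an arbitrary value when the series diverges.\<close>

definition hypergeometric :: "complex list \<Rightarrow> complex list \<Rightarrow> complex \<Rightarrow> complex" where
  "hypergeometric as bs z = eval_fps (fps_hypergeo as bs 1) z"

definition hypergeometric_converges :: "complex list \<Rightarrow> complex list \<Rightarrow> complex \<Rightarrow> bool" where
  "hypergeometric_converges as bs z \<longleftrightarrow>
     summable (\<lambda>k. fps_nth (fps_hypergeo as bs 1) k * z ^ k)"

lemma hypergeometric_eq_suminf:
  "hypergeometric as bs z =
     (\<Sum>k. (\<Prod>a\<leftarrow>as. pochhammer a k) / (fact k * (\<Prod>b\<leftarrow>bs. pochhammer b k)) * z ^ k)"
proof -
  have foldl_eq: "foldl (\<lambda>r c. r * pochhammer c k) u cs = u * (\<Prod>c\<leftarrow>cs. pochhammer c k)"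
    for k u and cs :: "complex list"
    by (induction cs arbitrary: u) (simp_all add: mult.assoc)
  show ?thesis
    by (simp add: hypergeometric_def eval_fps_def foldl_eq mult.commute)
qed

definition parameter_range :: "nat \<Rightarrow> (complex \<times> complex) set" where
  "parameter_range N = {(a, x). (\<forall>n::nat. n > 0 \<longrightarrow> a \<noteq> - of_nat n) \<and> Re x < real N + 2}"

text \<open>The points where all terms of the closed form are defined. Within the parameter range,
  \<open>a \<notin> \<int>\<^sub>\<le>\<^sub>0\<close> just means \<open>a \<noteq> 0\<close>, where \<open>\<psi>(a)\<close> has a pole. Under these conditions the
  denominators \<open>(a - x + 1)\<^sub>k\<close> do not vanish either.\<close>

definition regular_points :: "nat \<Rightarrow> (complex \<times> complex) set" where
  "regular_points N =
     {(a, x) \<in> parameter_range N. a \<notin> \<int>\<^sub>\<le>\<^sub>0 \<and> 1 - x \<notin> \<int>\<^sub>\<le>\<^sub>0 \<and> a - x + 1 \<notin> \<int>\<^sub>\<le>\<^sub>0}"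

definition closed_form :: "nat \<Rightarrow> complex \<Rightarrow> complex \<Rightarrow> complex" where
  "closed_form N a x =
     a * Gamma (a + of_nat N + 1) * Gamma (1 - x) / (fact N * Gamma (a - x + 1)) *
       (Digamma (a - x + 1) - Digamma a - Digamma (of_nat N + 1) - euler_mascheroni)
     - a * Gamma (a + of_nat N + 1) * Gamma (1 - x) / (fact N * Gamma (a - x + 1)) *
       (\<Sum>k=1..N. pochhammer a k * pochhammer (- of_nat N) k /
                  (of_nat k * fact k * pochhammer (a - x + 1) k))"

text \<open>The extension of the closed form by its limits, taken jointly in \<open>(a, x)\<close>.\<close>

definition closed_form_ext :: "nat \<Rightarrow> complex \<Rightarrow> complex \<Rightarrow> complex" where
  "closed_form_ext N a x =
     (if (a, x) \<in> regular_points N then closed_form N a x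
      else Lim (at (a, x) within regular_points N) (\<lambda>(b, y). closed_form N b y))"

end

theory Submission
  imports Defs "HOL-Complex_Analysis.Conformal_Mappings"
begin

text \<open>
  Since \<open>(a)\<^sub>k / (1 + a)\<^sub>k = a / (a + k)\<close> and
  \<open>(a)\<^sub>k / (1 + a + N)\<^sub>k = (a)\<^sub>N\<^sub>+\<^sub>1 / (a + k)\<^sub>N\<^sub>+\<^sub>1\<close>, the \<open>k\<close>-th term of the series is
  \<open>(x)\<^sub>k / k!\<close> times a rational function of \<open>a + k\<close>, whose partial fractions involve only
  \<open>1 / (a + k)\<^sup>2\<close> and \<open>1 / (a + j + k)\<close> with \<open>j \<le> N\<close>. For \<open>Re x < 1\<close> these can be summed separately:
  Gauss's summation theorem gives \<open>\<Sum>\<^sub>k (x)\<^sub>k / (k! (a + k)) = B(a, 1 - x)\<close>, and differentiation in \<open>a\<close>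
  gives the series with \<open>(a + k)\<^sup>2\<close> and hence the digamma values. Both sides are holomorphic in \<open>x\<close>
  off a countable closed set, which does not disconnect the half-plane \<open>Re x < N + 2\<close>, so the
  identity extends to all regular points. The series converges locally uniformly in \<open>(a, x)\<close>
  on the whole parameter range, and the regular points are dense there; hence its sum is the
  continuous extension of the closed form.
\<close>

subsection \<open>Locally uniform convergence of \<open>\<^sub>3F\<^sub>2\<close> at 1\<close>

text \<open>All five parameters stay free because three series use these terms: Gauss's series (with
  \<open>x\<close> and \<open>d\<close> equal to 1), the difference quotient of the beta function,
  and the series of the theorem.\<close>

definition hyp_term :: "complex \<Rightarrow> complex \<Rightarrow> complex \<Rightarrow> complex \<Rightarrow> complex \<Rightarrow> nat \<Rightarrow> complex" where
  "hyp_term a b x c d k =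
     pochhammer a k * pochhammer b k * pochhammer x k / (fact k * (pochhammer c k * pochhammer d k))"

lemma hyp_term_0 [simp]: "hyp_term a b x c d 0 = 1"
  by (simp add: hyp_term_def)

text \<open>Also true at a zero of a denominator, where division by 0 makes both sides 0.\<close>

lemma hyp_term_Suc:
  "hyp_term a b x c d (Suc k) = hyp_term a b x c d k *
     ((a + of_nat k) / (c + of_nat k) * ((b + of_nat k) / (d + of_nat k)) * ((x + of_nat k) / (1 + of_nat k)))"
  by (simp add: hyp_term_def pochhammer_Suc add_ac mult_ac)

text \<open>Replacing \<open>w + k\<close> by \<open>k\<close> costs
  \<open>z * w / (k * (w + k))\<close>, at most \<open>2 * B^2 / k^2\<close> since
  \<open>norm (w + k)\<close> is at least \<open>k / 2\<close>. With \<open>u = z / k\<close>, the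
  modulus of \<open>1 + u\<close> exceeds \<open>1 + Re u\<close> by at most
  \<open>B^2 / k^2\<close>. Together this is the constant 3.\<close>

lemma norm_shift_quotient_le:
  fixes z w :: complex
  assumes "norm z \<le> B" "norm w \<le> B" "real k \<ge> 2 * B" "B > 0"
  shows "norm (1 + z / (w + of_nat k)) \<le> exp (Re z / real k + 3 * B\<^sup>2 / (real k)\<^sup>2)"
proof -
  define t :: real where "t = real k"
  have t: "t > 0" "t \<ge> 2 * B" using assms by (auto simp: t_def)
  have wt: "norm (w + of_real t) \<ge> t / 2"
    using norm_triangle_ineq4[of "w + of_real t" w] assms t by simp
  hence w0: "w + of_real t \<noteq> 0" using t by auto
  define u where "u = z / of_real t"
  have Reu: "Re u = Re z / t" by (simp add: u_def)
  have "1 + z / (w + of_real t) = (1 + u) - z * w / (of_real t * (w + of_real t))"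
  proof -
    define v where "v = w + of_real t"
    have "z * w = z * v - z * of_real t" and "v \<noteq> 0" using w0 by (simp_all add: v_def algebra_simps)
    hence "z * w / (of_real t * v) = z / of_real t - z / v"
      using t(1) by (simp add: diff_divide_distrib)
    thus ?thesis by (simp add: u_def v_def)
  qed
  hence 1: "norm (1 + z / (w + of_real t)) \<le> norm (1 + u) + norm (z * w / (of_real t * (w + of_real t)))"
    by (simp only: norm_triangle_ineq4)
  have 2: "norm (z * w / (of_real t * (w + of_real t))) \<le> 2 * (B\<^sup>2 / t\<^sup>2)"
  proof -
    have "norm (z * w / (of_real t * (w + of_real t))) = (norm z * norm w) / (t * norm (w + of_real t))"
      using t(1) by (simp add: norm_mult norm_divide)
    also have "\<dots> \<le> (B * B) / (t * (t / 2))"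
      using assms t wt by (intro frac_le mult_mono mult_nonneg_nonneg mult_pos_pos) auto
    finally show ?thesis by (simp add: power2_eq_square mult_ac)
  qed
  have 3: "norm (1 + u) \<le> 1 + Re u + (norm u)\<^sup>2 / 2"
  proof -
    have "(norm (1 + u))\<^sup>2 = 1 + 2 * Re u + (norm u)\<^sup>2"
      unfolding cmod_power2 by (simp add: power2_eq_square algebra_simps)
    moreover have "2 * norm (1 + u) \<le> (norm (1 + u))\<^sup>2 + 1"
      using zero_le_power2[of "norm (1 + u) - 1"] unfolding power2_diff by simp
    ultimately show ?thesis by simp
  qed
  have 4: "(norm u)\<^sup>2 / 2 \<le> B\<^sup>2 / t\<^sup>2"
  proof -
    have "(norm u)\<^sup>2 \<le> B\<^sup>2 / t\<^sup>2" using assms t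
      by (simp add: u_def norm_divide power_divide divide_right_mono power_mono)
    thus ?thesis using zero_le_power2[of "norm u"] by linarith
  qed
  have 5: "1 + (Re z / t + 3 * (B\<^sup>2 / t\<^sup>2)) \<le> exp (Re z / t + 3 * (B\<^sup>2 / t\<^sup>2))"
    by (rule exp_ge_add_one_self)
  have "p \<le> e" if "p \<le> q + r" "r \<le> 2 * v" "q \<le> 1 + y + n" "n \<le> v" "1 + (y + 3 * v) \<le> e"
    for e n p q r v y :: real using that by linarith
  from this[OF 1 2 3[unfolded Reu] 4 5]
  have "norm (1 + z / (w + of_real t)) \<le> exp (Re z / t + 3 * (B\<^sup>2 / t\<^sup>2))" .
  thus ?thesis by (simp add: t_def)
qed

text \<open>The three factors of the term ratio are bounded by exponentials whose exponents add up
  to \<open>-(Re (c + d - a - b - x) + 1) / k\<close> plus an error of order \<open>1 / k^2\<close>.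
  For large \<open>k\<close> half of \<open>s\<close> absorbs the error. The threshold
  \<open>K\<close> depends on \<open>s\<close> and \<open>R\<close> alone, which makes the later
  estimates uniform in the parameters.\<close>

lemma hyp_term_ratio_bound:
  assumes "s > 0" "R > 0"
  obtains K where "K > 0" "\<And>a b x c d k. k \<ge> K \<Longrightarrow> norm a \<le> R \<Longrightarrow> norm b \<le> R \<Longrightarrow> norm x \<le> R \<Longrightarrow>
    norm c \<le> R \<Longrightarrow> norm d \<le> R \<Longrightarrow> Re (c + d - a - b - x) \<ge> s \<Longrightarrow>
    norm (hyp_term a b x c d (Suc k)) * real (Suc k) powr (1 + s / 2) \<le>
    norm (hyp_term a b x c d k) * real k powr (1 + s / 2)"
proof -
  \<comment> \<open>Bounds \<open>p - w\<close> for \<open>norm p \<le> R\<close> and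
    \<open>norm w \<le> R + 1\<close>; the extra 1 admits \<open>w = 1\<close>, from the factor
    \<open>1 + k\<close> of the factorial.\<close>
  define B where "B = 2 * R + 1"
  have B: "B > 0" "B \<ge> 1" using assms by (auto simp: B_def)
  \<comment> \<open>The first bound serves \<open>norm_shift_quotient_le\<close>; the second gives
    \<open>9 * B^2 / k \<le> s / 2\<close>, so that three quadratic errors cost at most
    \<open>s / 2\<close>.\<close>
  define K where "K = Suc (nat \<lceil>max (2 * B) (18 * B\<^sup>2 / s)\<rceil>)"
  show ?thesis
  proof (rule that[of K])
    show "K > 0" by (simp add: K_def)
    fix a b x c d :: complex and k
    assume k: "k \<ge> K" and n: "norm a \<le> R" "norm b \<le> R" "norm x \<le> R" "norm c \<le> R" "norm d \<le> R"
      and re: "Re (c + d - a - b - x) \<ge> s"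
    have "real k \<ge> max (2 * B) (18 * B\<^sup>2 / s)" using k unfolding K_def by linarith
    hence k2: "real k \<ge> 2 * B" and k3: "real k \<ge> 18 * B\<^sup>2 / s" by auto
    have k0: "real k > 0" using k2 B by linarith
    have q: "(p + of_nat k) / (w + of_nat k) = 1 + (p - w) / (w + of_nat k)" if "norm w \<le> B" for p w :: complex
    proof -
      have "norm (w + of_nat k) > 0"
        using norm_triangle_ineq4[of "w + of_nat k" w] that k2 B by (simp del: zero_less_norm_iff)
      thus ?thesis by (auto simp: field_simps)
    qed
    have nb: "norm (p - w) \<le> B" if "norm p \<le> R" "norm w \<le> R + 1" for p w :: complex
      using norm_triangle_ineq4[of p w] that by (simp add: B_def)
    have R1: "R + 1 \<le> B" using assms by (simp add: B_def)
    let ?e = "3 * B\<^sup>2 / (real k)\<^sup>2"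
    have e: "norm ((p + of_nat k) / (w + of_nat k)) \<le> exp (Re (p - w) / real k + ?e)"
      if "norm p \<le> R" "norm w \<le> R + 1" for p w
      using norm_shift_quotient_le[OF nb[OF that] _ k2 B(1), of w] q[of w p] that R1 by simp
    have "norm ((a + of_nat k) / (c + of_nat k) * ((b + of_nat k) / (d + of_nat k)) * ((x + of_nat k) / (1 + of_nat k)))
        \<le> exp (Re (a - c) / real k + ?e) * exp (Re (b - d) / real k + ?e) * exp (Re (x - 1) / real k + ?e)"
      unfolding norm_mult using n assms by (intro mult_mono mult_nonneg_nonneg e) auto
    also have "\<dots> = exp (- (Re (c + d - a - b - x) + 1) / real k + 3 * ?e)"
      by (simp flip: exp_add add: diff_divide_distrib add_divide_distrib)
    also have "\<dots> \<le> exp (- (1 + s / 2) / real k)"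
    proof -
      have "3 * ?e = (9 * B\<^sup>2 / real k) / real k" by (simp add: power2_eq_square)
      also have "\<dots> \<le> (s / 2) / real k"
        using k3 k0 assms by (intro divide_right_mono) (auto simp: field_simps)
      finally have "3 * ?e \<le> (s / 2) / real k" .
      moreover have "- (Re (c + d - a - b - x) + 1) / real k \<le> - (s + 1) / real k"
        using re k0 by (intro divide_right_mono) auto
      ultimately have "- (Re (c + d - a - b - x) + 1) / real k + 3 * ?e \<le> - (s + 1) / real k + (s / 2) / real k"
        by linarith
      also have "\<dots> = - (1 + s / 2) / real k"
        unfolding add_divide_distrib[symmetric] by simp
      finally show ?thesis by simp
    qed
    also have "\<dots> \<le> (real k / real (Suc k)) powr (1 + s / 2)"
    proof -
      have "ln (1 + 1 / real k) \<le> 1 / real k" using k0 by (intro ln_add_one_self_le_self) auto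
      moreover have "real k / real (Suc k) = inverse (1 + 1 / real k)" using k0 by (simp add: field_simps)
      ultimately have "ln (real k / real (Suc k)) \<ge> - (1 / real k)"
        by (simp add: ln_inverse)
      hence "(1 + s / 2) * - (1 / real k) \<le> (1 + s / 2) * ln (real k / real (Suc k))"
        using assms by (intro mult_left_mono) auto
      thus ?thesis using k0 by (simp add: powr_def field_simps)
    qed
    finally have "norm (hyp_term a b x c d (Suc k)) \<le> norm (hyp_term a b x c d k) * (real k / real (Suc k)) powr (1 + s / 2)"
      unfolding hyp_term_Suc norm_mult by (intro mult_left_mono) auto
    thus "norm (hyp_term a b x c d (Suc k)) * real (Suc k) powr (1 + s / 2) \<le>
        norm (hyp_term a b x c d k) * real k powr (1 + s / 2)"
      using k0 by (simp add: powr_divide field_simps)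
  qed
qed

text \<open>Iterates the monotonicity from \<open>K\<close> on. The parameters enter the majorant
  only through the \<open>K\<close>-th term, which is continuous in them.\<close>

lemma hyp_term_bound:
  assumes "s > 0" "R > 0"
  obtains K where "K > 0" "\<And>a b x c d k. k \<ge> K \<Longrightarrow> norm a \<le> R \<Longrightarrow> norm b \<le> R \<Longrightarrow> norm x \<le> R \<Longrightarrow>
    norm c \<le> R \<Longrightarrow> norm d \<le> R \<Longrightarrow> Re (c + d - a - b - x) \<ge> s \<Longrightarrow>
    norm (hyp_term a b x c d k) \<le> norm (hyp_term a b x c d K) * real K powr (1 + s / 2) * real k powr (- (1 + s / 2))"
proof -
  obtain K where K: "K > 0" "\<And>a b x c d k. k \<ge> K \<Longrightarrow> norm a \<le> R \<Longrightarrow> norm b \<le> R \<Longrightarrow> norm x \<le> R \<Longrightarrow>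
    norm c \<le> R \<Longrightarrow> norm d \<le> R \<Longrightarrow> Re (c + d - a - b - x) \<ge> s \<Longrightarrow>
    norm (hyp_term a b x c d (Suc k)) * real (Suc k) powr (1 + s / 2) \<le>
    norm (hyp_term a b x c d k) * real k powr (1 + s / 2)"
    using hyp_term_ratio_bound[OF assms] by blast
  show ?thesis
  proof (rule that[OF K(1)])
    fix a b x c d :: complex and k
    assume k: "k \<ge> K" and n: "norm a \<le> R" "norm b \<le> R" "norm x \<le> R" "norm c \<le> R" "norm d \<le> R"
      "Re (c + d - a - b - x) \<ge> s"
    have "norm (hyp_term a b x c d k) * real k powr (1 + s / 2) \<le> norm (hyp_term a b x c d K) * real K powr (1 + s / 2)"
      using k by (induction rule: dec_induct) (use K(2)[OF _ n] in \<open>auto intro: order_trans\<close>)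
    thus "norm (hyp_term a b x c d k) \<le> norm (hyp_term a b x c d K) * real K powr (1 + s / 2) * real k powr (- (1 + s / 2))"
      using k K(1) by (subst powr_minus) (simp add: field_simps)
  qed
qed

text \<open>Comparison with \<open>k powr (- (1 + s / 2))\<close>. The second claim makes the
  boundary term vanish when Gauss's contiguous relation is telescoped.\<close>

lemma summable_hyp_term:
  assumes "Re (c + d - a - b - x) > 0"
  shows "summable (hyp_term a b x c d)" "(\<lambda>k. of_nat k * hyp_term a b x c d k) \<longlonglongrightarrow> 0"
proof -
  define R where "R = 1 + norm a + norm b + norm x + norm c + norm d"
  have R: "R \<ge> 1" "norm a \<le> R" "norm b \<le> R" "norm x \<le> R" "norm c \<le> R" "norm d \<le> R"
    using norm_ge_zero[of a] norm_ge_zero[of b] norm_ge_zero[of x] norm_ge_zero[of c] norm_ge_zero[of d]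
    unfolding R_def by linarith+
  define s where "s = Re (c + d - a - b - x)"
  have s: "s > 0" using assms by (simp add: s_def)
  obtain K where "K > 0" and K: "\<And>a b x c d k. k \<ge> K \<Longrightarrow> norm a \<le> R \<Longrightarrow> norm b \<le> R \<Longrightarrow> norm x \<le> R \<Longrightarrow>
    norm c \<le> R \<Longrightarrow> norm d \<le> R \<Longrightarrow> Re (c + d - a - b - x) \<ge> s \<Longrightarrow>
    norm (hyp_term a b x c d k) \<le> norm (hyp_term a b x c d K) * real K powr (1 + s / 2) * real k powr (- (1 + s / 2))"
    using hyp_term_bound[of s R] R(1) s by auto
  define C where "C = norm (hyp_term a b x c d K) * real K powr (1 + s / 2)"
  have le: "norm (hyp_term a b x c d k) \<le> C * real k powr (- (1 + s / 2))" if "k \<ge> K" for k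
    unfolding C_def using K[OF that R(2-6)] by (simp add: s_def)
  show "summable (hyp_term a b x c d)"
  proof (rule summable_comparison_test[OF exI[of _ K]])
    show "summable (\<lambda>k. C * real k powr (- (1 + s / 2)))"
      using s by (intro summable_mult) (auto simp: summable_real_powr_iff)
  qed (use le in blast)
  have "(\<lambda>k. C * real k powr (- (s / 2))) \<longlonglongrightarrow> C * 0"
    using s by (intro tendsto_mult tendsto_const tendsto_neg_powr filterlim_real_sequentially) auto
  hence lim: "(\<lambda>k. C * real k powr (- (s / 2))) \<longlonglongrightarrow> 0" by simp
  show "(\<lambda>k. of_nat k * hyp_term a b x c d k) \<longlonglongrightarrow> 0"
  proof (rule Lim_null_comparison[OF _ lim], rule eventually_sequentiallyI[of K])
    fix k assume k: "k \<ge> K"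
    have "norm (of_nat k * hyp_term a b x c d k) \<le> real k * (C * real k powr (- (1 + s / 2)))"
      using le[OF k] by (simp add: norm_mult mult_left_mono)
    also have "real k * (C * real k powr (- (1 + s / 2))) = C * (real k powr 1 * real k powr (- (1 + s / 2)))"
      by simp
    also have "real k powr 1 * real k powr (- (1 + s / 2)) = real k powr (- (s / 2))"
      unfolding powr_add[symmetric] by simp
    finally show "norm (of_nat k * hyp_term a b x c d k) \<le> C * real k powr (- (s / 2))" .
  qed
qed

lemma continuous_on_hyp_term:
  assumes "continuous_on S a" "continuous_on S b" "continuous_on S x" "continuous_on S c" "continuous_on S d"
    and "\<And>p. p \<in> S \<Longrightarrow> c p \<notin> \<int>\<^sub>\<le>\<^sub>0" "\<And>p. p \<in> S \<Longrightarrow> d p \<notin> \<int>\<^sub>\<le>\<^sub>0"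
  shows "continuous_on S (\<lambda>p. hyp_term (a p) (b p) (x p) (c p) (d p) k)"
  unfolding hyp_term_def using assms
  by (intro continuous_intros) (auto dest: pochhammer_eq_0_imp_nonpos_Int)

text \<open>On a compact set the parameters are bounded, the excess attains a positive minimum
  \<open>s\<close>, and the \<open>K\<close>-th term is bounded by some \<open>T\<close>; the
  Weierstrass test then applies from index \<open>K\<close> on.\<close>

lemma uniform_limit_hyp_term:
  fixes S :: "'p::topological_space set"
  assumes "compact S"
    and cont: "continuous_on S a" "continuous_on S b" "continuous_on S x" "continuous_on S c" "continuous_on S d"
    and nz: "\<And>p. p \<in> S \<Longrightarrow> c p \<notin> \<int>\<^sub>\<le>\<^sub>0" "\<And>p. p \<in> S \<Longrightarrow> d p \<notin> \<int>\<^sub>\<le>\<^sub>0"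
    and pos: "\<And>p. p \<in> S \<Longrightarrow> Re (c p + d p - a p - b p - x p) > 0"
  shows "uniform_limit S (\<lambda>n p. \<Sum>k<n. hyp_term (a p) (b p) (x p) (c p) (d p) k)
           (\<lambda>p. \<Sum>k. hyp_term (a p) (b p) (x p) (c p) (d p) k) sequentially"
proof (cases "S = {}")
  case False
  have bd: "\<exists>B>0. \<forall>p\<in>S. norm (f p) \<le> B" if "continuous_on S f" for f :: "'p \<Rightarrow> complex"
    using compact_imp_bounded[OF compact_continuous_image[OF that \<open>compact S\<close>]]
    by (auto simp: bounded_pos)
  obtain Ra Rb Rx Rc Rd where
    Rs: "\<forall>p\<in>S. norm (a p) \<le> Ra" "\<forall>p\<in>S. norm (b p) \<le> Rb" "\<forall>p\<in>S. norm (x p) \<le> Rx"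
      "\<forall>p\<in>S. norm (c p) \<le> Rc" "\<forall>p\<in>S. norm (d p) \<le> Rd" and "Ra > 0"
    using bd[OF cont(1)] bd[OF cont(2)] bd[OF cont(3)] bd[OF cont(4)] bd[OF cont(5)] by metis
  define R where "R = Max {Ra, Rb, Rx, Rc, Rd}"
  have R0: "R > 0" using \<open>Ra > 0\<close> by (auto simp: R_def less_max_iff_disj)
  have "Ra \<le> R" "Rb \<le> R" "Rx \<le> R" "Rc \<le> R" "Rd \<le> R" by (auto simp: R_def)
  with Rs have R: "\<And>p. p \<in> S \<Longrightarrow> norm (a p) \<le> R" "\<And>p. p \<in> S \<Longrightarrow> norm (b p) \<le> R"
    "\<And>p. p \<in> S \<Longrightarrow> norm (x p) \<le> R" "\<And>p. p \<in> S \<Longrightarrow> norm (c p) \<le> R" "\<And>p. p \<in> S \<Longrightarrow> norm (d p) \<le> R"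
    by (meson order_trans)+
  obtain q where q: "q \<in> S" "\<And>p. p \<in> S \<Longrightarrow>
      Re (c q + d q - a q - b q - x q) \<le> Re (c p + d p - a p - b p - x p)"
  proof -
    have "continuous_on S (\<lambda>p. Re (c p + d p - a p - b p - x p))"
      by (intro continuous_intros cont)
    from continuous_attains_inf[OF \<open>compact S\<close> False this] that show ?thesis by blast
  qed
  define s where "s = Re (c q + d q - a q - b q - x q)"
  have s: "s > 0" using pos[OF q(1)] by (simp add: s_def)
  obtain K where "K > 0" and K: "\<And>a b x c d k. k \<ge> K \<Longrightarrow> norm a \<le> R \<Longrightarrow> norm b \<le> R \<Longrightarrow> norm x \<le> R \<Longrightarrow>
    norm c \<le> R \<Longrightarrow> norm d \<le> R \<Longrightarrow> Re (c + d - a - b - x) \<ge> s \<Longrightarrow>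
    norm (hyp_term a b x c d k) \<le> norm (hyp_term a b x c d K) * real K powr (1 + s / 2) * real k powr (- (1 + s / 2))"
    using hyp_term_bound[of s R] R0 s by auto
  obtain T where T: "T > 0" "\<And>p. p \<in> S \<Longrightarrow> norm (hyp_term (a p) (b p) (x p) (c p) (d p) K) \<le> T"
    using bd[OF continuous_on_hyp_term[OF cont nz, of K]] by auto
  show ?thesis
  proof (rule Weierstrass_m_test_ev)
    show "summable (\<lambda>k. T * real K powr (1 + s / 2) * real k powr (- (1 + s / 2)))"
      using s by (intro summable_mult) (auto simp: summable_real_powr_iff)
    show "\<forall>\<^sub>F k in sequentially. \<forall>p\<in>S. norm (hyp_term (a p) (b p) (x p) (c p) (d p) k)
            \<le> T * real K powr (1 + s / 2) * real k powr (- (1 + s / 2))"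
    proof (intro eventually_sequentiallyI[of K] ballI)
      fix k p assume "k \<ge> K" "p \<in> S"
      have "norm (hyp_term (a p) (b p) (x p) (c p) (d p) k) \<le>
          norm (hyp_term (a p) (b p) (x p) (c p) (d p) K) * real K powr (1 + s / 2) * real k powr (- (1 + s / 2))"
        using q(2)[OF \<open>p \<in> S\<close>] by (intro K R \<open>k \<ge> K\<close> \<open>p \<in> S\<close>) (simp_all add: s_def)
      also have "\<dots> \<le> T * real K powr (1 + s / 2) * real k powr (- (1 + s / 2))"
        by (intro mult_right_mono T \<open>p \<in> S\<close>) auto
      finally show "norm (hyp_term (a p) (b p) (x p) (c p) (d p) k) \<le>
          T * real K powr (1 + s / 2) * real k powr (- (1 + s / 2))" .
    qed
  qed
qed (auto simp: uniform_limit_iff)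

lemma continuous_on_hyp_suminf:
  fixes S :: "'p::{heine_borel} set"
  assumes "open S"
    and cont: "continuous_on S a" "continuous_on S b" "continuous_on S x" "continuous_on S c" "continuous_on S d"
    and nz: "\<And>p. p \<in> S \<Longrightarrow> c p \<notin> \<int>\<^sub>\<le>\<^sub>0" "\<And>p. p \<in> S \<Longrightarrow> d p \<notin> \<int>\<^sub>\<le>\<^sub>0"
    and pos: "\<And>p. p \<in> S \<Longrightarrow> Re (c p + d p - a p - b p - x p) > 0"
  shows "continuous_on S (\<lambda>p. \<Sum>k. hyp_term (a p) (b p) (x p) (c p) (d p) k)"
proof (subst continuous_on_eq_continuous_at[OF \<open>open S\<close>], intro ballI)
  fix p assume "p \<in> S"
  then obtain e where e: "e > 0" "cball p e \<subseteq> S" using \<open>open S\<close> open_contains_cball by blast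
  have "continuous_on (cball p e) (\<lambda>p. \<Sum>k. hyp_term (a p) (b p) (x p) (c p) (d p) k)"
  proof -
    note cont' = cont[THEN continuous_on_subset, OF e(2)]
    have nz': "c q \<notin> \<int>\<^sub>\<le>\<^sub>0" "d q \<notin> \<int>\<^sub>\<le>\<^sub>0" and pos': "Re (c q + d q - a q - b q - x q) > 0"
      if "q \<in> cball p e" for q
      using that e(2) nz pos by blast+
    show ?thesis
      by (rule uniform_limit_theorem[OF _ uniform_limit_hyp_term[OF compact_cball cont' nz' pos']])
         (auto intro!: always_eventually continuous_on_sum continuous_on_hyp_term[OF cont' nz'])
  qed
  thus "isCont (\<lambda>p. \<Sum>k. hyp_term (a p) (b p) (x p) (c p) (d p) k) p"
    using e(1) by (rule_tac continuous_on_interior) (auto intro: ball_subset_cball[THEN interior_maximal, THEN subsetD])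
qed

lemma holomorphic_on_hyp_suminf:
  assumes "open S" "c \<notin> \<int>\<^sub>\<le>\<^sub>0" "d \<notin> \<int>\<^sub>\<le>\<^sub>0" and "\<And>x. x \<in> S \<Longrightarrow> Re (c + d - a - b - x) > 0"
  shows "(\<lambda>x. \<Sum>k. hyp_term a b x c d k) holomorphic_on S"
proof (rule holomorphic_uniform_sequence[OF \<open>open S\<close>])
  show "(\<lambda>x. \<Sum>k<n. hyp_term a b x c d k) holomorphic_on S" for n
    unfolding hyp_term_def pochhammer_prod using assms(2,3)
    by (intro holomorphic_intros)
       (auto dest!: pochhammer_eq_0_imp_nonpos_Int simp flip: pochhammer_prod)
next
  fix z assume "z \<in> S"
  then obtain e where e: "e > 0" "cball z e \<subseteq> S" using \<open>open S\<close> open_contains_cball by blast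
  have "uniform_limit (cball z e) (\<lambda>n x. \<Sum>k<n. hyp_term a b x c d k) (\<lambda>x. \<Sum>k. hyp_term a b x c d k) sequentially"
    using assms e by (intro uniform_limit_hyp_term continuous_intros) auto
  thus "\<exists>e>0. cball z e \<subseteq> S \<and> uniform_limit (cball z e) (\<lambda>n x. \<Sum>k<n. hyp_term a b x c d k)
      (\<lambda>x. \<Sum>k. hyp_term a b x c d k) sequentially" using e by blast
qed

subsection \<open>Gauss's summation theorem\<close>

lemma norm_pochhammer_le: "norm (pochhammer (z :: complex) k) \<le> pochhammer (norm z) k"
  unfolding pochhammer_prod prod_norm[symmetric]
  by (intro prod_mono conjI norm_ge_zero order_trans[OF norm_triangle_ineq]) simp

lemma pochhammer_le_norm_pochhammer:
  assumes "C > 0" "C \<le> Re z"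
  shows "pochhammer C k \<le> norm (pochhammer z k)"
  unfolding pochhammer_prod prod_norm[symmetric] using assms
  by (intro prod_mono conjI order_trans[OF _ complex_Re_le_cmod]) auto

lemma not_nonpos_Int_add_nat: "z \<notin> \<int>\<^sub>\<le>\<^sub>0 \<Longrightarrow> z + of_nat n \<notin> \<int>\<^sub>\<le>\<^sub>0" for z :: complex
  using nonpos_Ints_diff_Nats[of "z + of_nat n" "of_nat n"] by auto

text \<open>Both \<open>a * pochhammer (a + 1) k\<close> and \<open>pochhammer a k * (a + k)\<close>
  equal \<open>pochhammer a (k + 1)\<close>.\<close>

lemma pochhammer_shift_quotient:
  fixes a :: complex
  assumes "a \<notin> \<int>\<^sub>\<le>\<^sub>0"
  shows "pochhammer a k / pochhammer (a + 1) k = a / (a + of_nat k)"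
proof -
  have "a * pochhammer (a + 1) k = pochhammer a k * (a + of_nat k)"
    using pochhammer_rec[of a k] pochhammer_rec'[of a k] by (simp add: mult.commute)
  moreover have "a + of_nat k \<noteq> 0" "pochhammer (a + 1) k \<noteq> 0"
    using assms not_nonpos_Int_add_nat[of a 1] plus_of_nat_eq_0_imp[of a k]
      pochhammer_eq_0_imp_nonpos_Int[of "a + 1" k] by auto
  ultimately show ?thesis by (simp add: field_simps)
qed

text \<open>The parameters \<open>1\<close> above and below cancel, so that this is \<open>\<^sub>2F\<^sub>1(a, b; c; 1)\<close>.\<close>

abbreviation gauss_sum :: "complex \<Rightarrow> complex \<Rightarrow> complex \<Rightarrow> complex" where
  "gauss_sum a b c \<equiv> (\<Sum>k. hyp_term a b 1 c 1 k)"

lemma hyp_term_gauss: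
  "hyp_term a b 1 c 1 k = pochhammer a k * pochhammer b k / fact k * (1 / pochhammer c k)"
  by (simp add: hyp_term_def fact_nonzero flip: pochhammer_fact)

text \<open>The difference of both sides telescopes, with \<open>c k t\<^sub>k\<close> as antidifference up to sign, where \<open>t\<^sub>k\<close> is the
  \<open>k\<close>-th term of the series on the left.\<close>

lemma gauss_contiguous:
  assumes "c \<notin> \<int>\<^sub>\<le>\<^sub>0" "Re (c - a - b) > 0"
  shows "c * (c - a - b) * gauss_sum a b c = (c - a) * (c - b) * gauss_sum a b (c + 1)"
proof -
  have c1: "c + of_nat k \<noteq> 0" for k using assms(1) plus_of_nat_eq_0_imp by blast
  have pc: "pochhammer c k \<noteq> 0" for k using assms(1) pochhammer_eq_0_imp_nonpos_Int by blast
  have sm: "summable (hyp_term a b 1 c 1)" "summable (hyp_term a b 1 (c + 1) 1)"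
    and lim: "(\<lambda>k. of_nat k * hyp_term a b 1 c 1 k) \<longlonglongrightarrow> 0"
    using assms(2) by (intro summable_hyp_term; simp)+
  define w where "w k = c * (of_nat k * hyp_term a b 1 c 1 k)" for k
  have shift: "hyp_term a b 1 (c + 1) 1 k = hyp_term a b 1 c 1 k * (c / (c + of_nat k))" for k
  proof -
    have "1 / pochhammer (c + 1) k = 1 / pochhammer c k * (c / (c + of_nat k))"
      unfolding pochhammer_shift_quotient[OF assms(1), symmetric] using pc[of k] by simp
    thus ?thesis unfolding hyp_term_gauss by simp
  qed
  have tel: "c * (c - a - b) * hyp_term a b 1 c 1 k - (c - a) * (c - b) * hyp_term a b 1 (c + 1) 1 k =
      w k - w (Suc k)" for k
  proof -
    define t where "t = hyp_term a b 1 c 1 k"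
    define r where "r = (c + of_nat k)"
    have r: "r \<noteq> 0" using c1 by (simp add: r_def)
    \<comment> \<open>With \<open>k\<close> replaced by \<open>r - c\<close>, the claim becomes a
      polynomial identity once the denominator \<open>r\<close> is cleared.\<close>
    have k: "of_nat k = r - c" by (simp add: r_def)
    define m :: complex where "m = 1 + of_nat k"
    have m: "m \<noteq> 0" unfolding m_def by (metis of_nat_Suc of_nat_neq_0)
    have "w (Suc k) = c * (m * (t * ((a + of_nat k) / r * ((b + of_nat k) / m) * (m / m))))"
      by (simp add: w_def hyp_term_Suc t_def r_def m_def)
    also have "\<dots> = c * (t * ((a + of_nat k) * (b + of_nat k) / r))"
      using m by simp
    finally show ?thesis unfolding shift w_def t_def[symmetric] r_def[symmetric] using r
      by (simp add: k field_simps)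
  qed
  have "w \<longlonglongrightarrow> c * 0" unfolding w_def by (intro tendsto_intros lim)
  from telescope_sums'[OF this] have "(\<lambda>k. w k - w (Suc k)) sums 0" by (simp add: w_def)
  moreover have "(\<lambda>k. w k - w (Suc k)) sums
      (c * (c - a - b) * gauss_sum a b c - (c - a) * (c - b) * gauss_sum a b (c + 1))"
    unfolding tel[symmetric] by (intro sums_diff sums_mult summable_sums sm)
  ultimately show ?thesis using sums_unique2 by fastforce
qed

text \<open>Each step raises \<open>c\<close> and the excess \<open>c - a - b\<close> by 1, so the
  hypotheses persist. The product form matches \<open>rGamma_series\<close>.\<close>

lemma gauss_contiguous_nat:
  assumes "c \<notin> \<int>\<^sub>\<le>\<^sub>0" "Re (c - a - b) > 0"
  shows "pochhammer c n * pochhammer (c - a - b) n * gauss_sum a b c =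
    pochhammer (c - a) n * pochhammer (c - b) n * gauss_sum a b (c + of_nat n)"
proof (induction n)
  case (Suc n)
  have "(c + of_nat n) * (c + of_nat n - a - b) * gauss_sum a b (c + of_nat n) =
      (c + of_nat n - a) * (c + of_nat n - b) * gauss_sum a b (c + of_nat n + 1)"
    using assms by (intro gauss_contiguous not_nonpos_Int_add_nat) auto
  hence *: "(c + of_nat n) * (c - a - b + of_nat n) * gauss_sum a b (c + of_nat n) =
      (c - a + of_nat n) * (c - b + of_nat n) * gauss_sum a b (c + of_nat (Suc n))"
    by (simp add: algebra_simps)
  have "pochhammer c (Suc n) * pochhammer (c - a - b) (Suc n) * gauss_sum a b c =
     (c + of_nat n) * (c - a - b + of_nat n) * (pochhammer c n * pochhammer (c - a - b) n * gauss_sum a b c)"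
    by (simp add: pochhammer_Suc)
  also have "\<dots> = pochhammer (c - a) n * pochhammer (c - b) n *
     ((c + of_nat n) * (c - a - b + of_nat n) * gauss_sum a b (c + of_nat n))"
    unfolding Suc by (simp add: mult_ac)
  also have "\<dots> = pochhammer (c - a) (Suc n) * pochhammer (c - b) (Suc n) * gauss_sum a b (c + of_nat (Suc n))"
    unfolding * by (simp add: pochhammer_Suc)
  finally show ?case .
qed simp

text \<open>Every term but the zeroth tends to 0, and Tannery's theorem allows the limit inside the
  sum. The majorant is the Gauss series at \<open>norm a\<close>, \<open>norm b\<close>,
  \<open>C\<close>, valid as soon as \<open>Re c + n \<ge> C\<close>.\<close>

lemma gauss_sum_limit: "(\<lambda>n. gauss_sum a b (c + of_nat n)) \<longlonglongrightarrow> 1"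
proof -
  \<comment> \<open>Gives the majorant series the excess \<open>C - norm a - norm b = 1\<close>,
    hence convergence.\<close>
  define C where "C = norm a + norm b + 1"
  have C: "C > 0" by (simp add: C_def add_nonneg_pos)
  define M where "M k = pochhammer (norm a) k * pochhammer (norm b) k / (fact k * pochhammer C k)" for k
  have "summable (hyp_term (of_real (norm a)) (of_real (norm b)) 1 (of_real C) 1)"
    by (intro summable_hyp_term) (simp add: C_def)
  also have "hyp_term (of_real (norm a)) (of_real (norm b)) 1 (of_real C) 1 = (\<lambda>k. of_real (M k))"
    by (simp add: hyp_term_def M_def pochhammer_of_real fact_nonzero fun_eq_iff flip: pochhammer_fact)
  finally have M: "summable M" by (simp only: summable_of_real_iff)
  have "(\<lambda>n. gauss_sum a b (c + of_nat n)) \<longlonglongrightarrow> (\<Sum>k. if k = 0 then 1 else 0)"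
  proof (rule tannerys_theorem[OF _ _ M sequentially_bot, THEN conjunct2, THEN conjunct2])
    fix k :: nat
    show "(\<lambda>n. hyp_term a b 1 (c + of_nat n) 1 k) \<longlonglongrightarrow> (if k = 0 then 1 else 0)"
    proof (cases k)
      case (Suc j)
      have "filterlim (\<lambda>n. Re c + real n) at_top sequentially"
        by (rule filterlim_tendsto_add_at_top[OF tendsto_const filterlim_real_sequentially])
      hence ev: "eventually (\<lambda>n. Re c + real n \<ge> 1) sequentially"
        by (simp add: filterlim_at_top)
      have "(\<lambda>n. norm (pochhammer a k * pochhammer b k / fact k) * (1 / (Re c + real n))) \<longlonglongrightarrow>
          norm (pochhammer a k * pochhammer b k / fact k) * 0"
        by (intro tendsto_intros real_tendsto_divide_at_top[OF tendsto_const]) fact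
      hence lim: "(\<lambda>n. norm (pochhammer a k * pochhammer b k / fact k) * (1 / (Re c + real n))) \<longlonglongrightarrow> 0"
        by simp
      have "(\<lambda>n. hyp_term a b 1 (c + of_nat n) 1 k) \<longlonglongrightarrow> 0"
      proof (rule Lim_null_comparison[OF _ lim], use ev in eventually_elim)
        case (elim n)
        have "pochhammer (Re c + real n) k \<le> norm (pochhammer (c + of_nat n) k)"
          using elim by (intro pochhammer_le_norm_pochhammer) auto
        moreover have "pochhammer (Re c + real n) k \<ge> Re c + real n"
        proof -
          have "1 \<le> pochhammer (Re c + real n + 1) j"
            unfolding pochhammer_prod using elim by (intro prod_ge_1) auto
          thus ?thesis using elim mult_left_mono[of 1 "pochhammer (Re c + real n + 1) j" "Re c + real n"]
            by (simp add: Suc pochhammer_rec)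
        qed
        ultimately have *: "Re c + real n \<le> norm (pochhammer (c + of_nat n) k)" by linarith
        have "hyp_term a b 1 (c + of_nat n) 1 k =
           pochhammer a k * pochhammer b k / fact k * (1 / pochhammer (c + of_nat n) k)"
          by (simp add: hyp_term_def fact_nonzero flip: pochhammer_fact)
        also have "norm \<dots> = norm (pochhammer a k * pochhammer b k / fact k) * (1 / norm (pochhammer (c + of_nat n) k))"
          unfolding norm_mult[of "_ / _"] by (simp add: norm_divide)
        also have "\<dots> \<le> norm (pochhammer a k * pochhammer b k / fact k) * (1 / (Re c + real n))"
          using * elim by (intro mult_left_mono divide_left_mono mult_pos_pos) auto
        finally show ?case .
      qed
      thus ?thesis using Suc by simp
    qed simp
  next
    have "filterlim (\<lambda>n. Re c + real n) at_top sequentially"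
      by (rule filterlim_tendsto_add_at_top[OF tendsto_const filterlim_real_sequentially])
    hence ev: "eventually (\<lambda>n. Re c + real n \<ge> C) sequentially"
      by (simp add: filterlim_at_top)
    show "\<forall>\<^sub>F (k, n) in at_top \<times>\<^sub>F sequentially. norm (hyp_term a b 1 (c + of_nat n) 1 k) \<le> M k"
    proof (rule eventually_prodI[OF always_eventually ev, THEN eventually_mono])
      show "\<forall>k::nat. True" by simp
      fix z :: "nat \<times> nat" assume *: "True \<and> C \<le> Re c + real (snd z)"
      obtain k n where z: "z = (k, n)" by force
      have "norm (hyp_term a b 1 (c + of_nat n) 1 k) =
          norm (pochhammer a k) * norm (pochhammer b k) / (fact k * norm (pochhammer (c + of_nat n) k))"
        by (simp add: hyp_term_def norm_mult norm_divide fact_nonzero flip: pochhammer_fact)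
      also have "\<dots> \<le> M k" unfolding M_def using C * z
        by (intro frac_le mult_mono mult_left_mono norm_pochhammer_le pochhammer_le_norm_pochhammer
            mult_nonneg_nonneg mult_pos_pos pochhammer_pos order_trans[OF norm_ge_zero norm_pochhammer_le]) auto
      finally show "case z of (k, n) \<Rightarrow> norm (hyp_term a b 1 (c + of_nat n) 1 k) \<le> M k" by (simp add: z)
    qed
  qed
  moreover have "(\<Sum>k. if k = (0::nat) then 1 else 0 :: complex) = 1"
    using suminf_finite[of "{0::nat}" "\<lambda>k. if k = 0 then 1 else 0 :: complex"] by auto
  ultimately show ?thesis by simp
qed

text \<open>Dividing the iterated relation by factorials and powers of \<open>n\<close> gives
  products of \<open>rGamma_series\<close>; the powers agree since
  \<open>c + (c - a - b) = (c - a) + (c - b)\<close>. Let \<open>n\<close> tend to infinity. At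
  poles of \<open>Gamma (c - a)\<close> or \<open>Gamma (c - b)\<close> the right-hand side is 0 by
  division by 0, in accordance with \<open>rGamma\<close>.\<close>

lemma gauss_summation:
  assumes "c \<notin> \<int>\<^sub>\<le>\<^sub>0" "Re (c - a - b) > 0"
  shows "gauss_sum a b c = Gamma c * Gamma (c - a - b) / (Gamma (c - a) * Gamma (c - b))"
proof -
  have cab: "c - a - b \<notin> \<int>\<^sub>\<le>\<^sub>0"
    using assms(2) by (auto elim!: nonpos_Ints_cases' dest: arg_cong[of _ _ Re])
  have eq: "rGamma_series c n * rGamma_series (c - a - b) n * gauss_sum a b c =
     rGamma_series (c - a) n * rGamma_series (c - b) n * gauss_sum a b (c + of_nat (n + 1))" for n
  proof -
    have e: "exp (c * L) * exp ((c - a - b) * L) = exp ((c - a) * L) * exp ((c - b) * L)" for L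
      by (simp flip: exp_add add: algebra_simps)
    show ?thesis
      using gauss_contiguous_nat[OF assms, of "n + 1"] e[of "of_real (ln (of_nat n))"]
      unfolding rGamma_series_def by (simp add: divide_simps)
  qed
  have "(\<lambda>n. rGamma_series c n * rGamma_series (c - a - b) n * gauss_sum a b c) \<longlonglongrightarrow>
      rGamma c * rGamma (c - a - b) * gauss_sum a b c"
    by (intro tendsto_intros)
  moreover have "(\<lambda>n. rGamma_series c n * rGamma_series (c - a - b) n * gauss_sum a b c) \<longlonglongrightarrow>
      rGamma (c - a) * rGamma (c - b) * 1"
    unfolding eq by (intro tendsto_intros LIMSEQ_ignore_initial_segment gauss_sum_limit)
  ultimately have "rGamma c * rGamma (c - a - b) * gauss_sum a b c = rGamma (c - a) * rGamma (c - b)"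
    using LIMSEQ_unique by fastforce
  thus ?thesis using assms(1) cab
    by (simp add: rGamma_inverse_Gamma Gamma_eq_zero_iff field_simps)
qed

subsection \<open>Series for the beta function\<close>

text \<open>Gauss's theorem with third parameter \<open>a + 1\<close>: the quotient of
  \<open>pochhammer a k\<close> and \<open>pochhammer (a + 1) k\<close> is
  \<open>a / (a + k)\<close>, and the excess is \<open>1 - x\<close>.\<close>

lemma sums_Beta:
  assumes "a \<notin> \<int>\<^sub>\<le>\<^sub>0" "Re x < 1"
  shows "(\<lambda>k. pochhammer x k / fact k / (a + of_nat k)) sums Beta a (1 - x)"
proof -
  have a0: "a \<noteq> 0" using assms(1) by auto
  have a1: "a + 1 \<notin> \<int>\<^sub>\<le>\<^sub>0" using not_nonpos_Int_add_nat[OF assms(1), of 1] by simp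
  have eq: "hyp_term a x 1 (a + 1) 1 k = a * (pochhammer x k / fact k / (a + of_nat k))" for k
  proof -
    have "hyp_term a x 1 (a + 1) 1 k = pochhammer x k / fact k * (pochhammer a k / pochhammer (a + 1) k)"
      unfolding hyp_term_gauss by simp
    thus ?thesis unfolding pochhammer_shift_quotient[OF assms(1)] by simp
  qed
  have "hyp_term a x 1 (a + 1) 1 sums gauss_sum a x (a + 1)"
    using assms by (intro summable_sums summable_hyp_term) auto
  also have "gauss_sum a x (a + 1) = Gamma (a + 1) * Gamma (1 - x) / Gamma (a + (1 - x))"
    using assms a1 by (subst gauss_summation) (auto simp: algebra_simps)
  also have "\<dots> = a * Beta a (1 - x)"
    by (simp add: Gamma_plus1[OF assms(1)] Beta_def)
  finally have "(\<lambda>k. a * (pochhammer x k / fact k / (a + of_nat k))) sums (a * Beta a (1 - x))"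
    unfolding eq .
  thus ?thesis using a0 by (subst (asm) sums_mult_iff) auto
qed

text \<open>Instead of differentiating termwise, the difference quotient of the beta function at \<open>a\<close> and
  \<open>b\<close> is written as a \<open>\<^sub>3F\<^sub>2\<close> series, which is continuous in \<open>b\<close>.\<close>

lemma sums_Beta_deriv:
  assumes "a \<notin> \<int>\<^sub>\<le>\<^sub>0" "a - x + 1 \<notin> \<int>\<^sub>\<le>\<^sub>0" "Re x < 1"
  shows "(\<lambda>k. pochhammer x k / fact k / (a + of_nat k)\<^sup>2) sums
           (Beta a (1 - x) * (Digamma (a - x + 1) - Digamma a))"
proof -
  define S where "S = - (\<int>\<^sub>\<le>\<^sub>0 :: complex set)"
  have S: "open S" "a \<in> S" using assms(1) by (auto simp: S_def)
  define T where "T b = (\<Sum>k. hyp_term a b x (a + 1) (b + 1) k)" for b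
  have hterm: "hyp_term a b x (a + 1) (b + 1) k =
      a * b * (pochhammer x k / fact k / ((a + of_nat k) * (b + of_nat k)))" if "b \<in> S" for b k
  proof -
    have "hyp_term a b x (a + 1) (b + 1) k = pochhammer x k / fact k *
        (pochhammer a k / pochhammer (a + 1) k) * (pochhammer b k / pochhammer (b + 1) k)"
      unfolding hyp_term_def times_divide_times_eq by (simp only: mult_ac)
    moreover have "b \<notin> \<int>\<^sub>\<le>\<^sub>0" using that by (simp add: S_def)
    ultimately show ?thesis
      unfolding pochhammer_shift_quotient[OF assms(1)] by (simp add: pochhammer_shift_quotient mult_ac)
  qed
  have sums: "hyp_term a b x (a + 1) (b + 1) sums T b" for b
    unfolding T_def using assms by (intro summable_sums summable_hyp_term) auto
  have nz: "b + 1 \<notin> \<int>\<^sub>\<le>\<^sub>0" "b \<noteq> 0" "b + of_nat k \<noteq> 0" if "b \<in> S" for b k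
    using not_nonpos_Int_add_nat[of b 1] that plus_of_nat_eq_0_imp[of b k] by (auto simp: S_def)
  have cont: "continuous_on S T"
    unfolding T_def using S nz assms
    by (intro continuous_on_hyp_suminf continuous_intros) auto
  have Tb: "T b = - a * b * ((Beta b (1 - x) - Beta a (1 - x)) / (b - a))" if "b \<in> S" "b \<noteq> a" for b
  proof -
    have "(\<lambda>k. a * b / (b - a) * (pochhammer x k / fact k / (a + of_nat k) - pochhammer x k / fact k / (b + of_nat k)))
        sums (a * b / (b - a) * (Beta a (1 - x) - Beta b (1 - x)))"
      using that assms S by (intro sums_mult sums_diff sums_Beta) (auto simp: S_def)
    also have "(\<lambda>k. a * b / (b - a) * (pochhammer x k / fact k / (a + of_nat k) - pochhammer x k / fact k / (b + of_nat k)))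
        = hyp_term a b x (a + 1) (b + 1)"
    proof
      fix k
      have "1 / (b - a) * (1 / (a + of_nat k) - 1 / (b + of_nat k)) = 1 / ((a + of_nat k) * (b + of_nat k))"
        using nz(3)[OF S(2), of k] nz(3)[OF that(1), of k] that(2) by (simp add: divide_simps)
      hence "a * b * (pochhammer x k / fact k) * (1 / (b - a) * (1 / (a + of_nat k) - 1 / (b + of_nat k))) =
          a * b * (pochhammer x k / fact k) * (1 / ((a + of_nat k) * (b + of_nat k)))"
        by (rule arg_cong)
      thus "a * b / (b - a) * (pochhammer x k / fact k / (a + of_nat k) - pochhammer x k / fact k / (b + of_nat k))
        = hyp_term a b x (a + 1) (b + 1) k"
        unfolding hterm[OF that(1)] by (simp add: right_diff_distrib mult_ac)
    qed
    finally have "a * b / (b - a) * (Beta a (1 - x) - Beta b (1 - x)) = T b"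
      using sums sums_unique2 by blast
    thus ?thesis by (simp add: right_diff_distrib diff_divide_distrib)
  qed
  \<comment> \<open>The value \<open>T a\<close> is found by computing the limit of \<open>T\<close>
    at \<open>a\<close> twice: by continuity of the series, and from \<open>Tb\<close> as a
    derivative of the beta function.\<close>
  have "(T \<longlongrightarrow> T a) (at a)"
    using cont S by (simp add: continuous_on_eq_continuous_at isCont_def)
  moreover have "(T \<longlongrightarrow> - a * a * (Beta a (1 - x) * (Digamma a - Digamma (a + (1 - x))))) (at a)"
  proof (rule Lim_transform_eventually)
    have "((\<lambda>b. Beta b (1 - x)) has_field_derivative (Beta a (1 - x) * (Digamma a - Digamma (a + (1 - x))))) (at a)"
      using assms(1,2) by (intro has_field_derivative_Beta1) (auto simp: algebra_simps)
    thus "((\<lambda>b. - a * b * ((Beta b (1 - x) - Beta a (1 - x)) / (b - a))) \<longlongrightarrow>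
      - a * a * (Beta a (1 - x) * (Digamma a - Digamma (a + (1 - x))))) (at a)"
      unfolding has_field_derivative_iff by (intro tendsto_intros)
    show "\<forall>\<^sub>F b in at a. - a * b * ((Beta b (1 - x) - Beta a (1 - x)) / (b - a)) = T b"
      using S Tb by (auto simp: eventually_at_topological)
  qed
  ultimately have Ta: "T a = - a * a * (Beta a (1 - x) * (Digamma a - Digamma (a + (1 - x))))"
    using tendsto_unique trivial_limit_at by blast
  have "(\<lambda>k. a * a * (pochhammer x k / fact k / ((a + of_nat k) * (a + of_nat k)))) sums T a"
    using sums[of a] unfolding hterm[OF S(2), THEN ext] .
  also have "T a = a * a * (Beta a (1 - x) * (Digamma (a - x + 1) - Digamma a))"
    unfolding Ta by (simp add: algebra_simps)
  finally show ?thesis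
    using nz(2)[OF S(2)] by (subst (asm) sums_mult_iff) (auto simp: power2_eq_square)
qed

text \<open>This is the terminating case \<open>x = - N\<close> of the beta series.\<close>

lemma fact_over_pochhammer:
  fixes z :: complex
  assumes "z \<notin> \<int>\<^sub>\<le>\<^sub>0"
  shows "fact N / pochhammer z (N + 1) = (\<Sum>k\<le>N. pochhammer (- of_nat N) k / fact k / (z + of_nat k))"
proof -
  have 1: "(\<lambda>k. pochhammer (- of_nat N) k / fact k / (z + of_nat k)) sums Beta z (1 - (- of_nat N))"
    using assms by (intro sums_Beta) auto
  have 2: "(\<lambda>k. pochhammer (- of_nat N) k / fact k / (z + of_nat k)) sums
      (\<Sum>k\<le>N. pochhammer (- of_nat N) k / fact k / (z + of_nat k))"
    by (rule sums_finite) (auto simp: pochhammer_of_nat_eq_0_iff)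
  have "Beta z (1 - (- of_nat N)) = fact N / pochhammer z (N + 1)"
    using assms by (simp add: Beta_def pochhammer_Gamma Gamma_fact add_ac)
  thus ?thesis using sums_unique2[OF 1 2] by simp
qed

section \<open>An alternating binomial sum for the harmonic numbers\<close>

lemma pochhammer_minus_over_fact:
  "pochhammer (- of_nat N :: 'a::field_char_0) k / fact k = (-1) ^ k * of_nat (N choose k)"
  by (simp add: binomial_gbinomial gbinomial_pochhammer)

text \<open>By Pascal's rule and \<open>k * (Suc N choose k) = Suc N * (N choose (k - 1))\<close>,
  the increment from \<open>N\<close> to \<open>Suc N\<close> is an alternating row sum without its
  zeroth term, that is -1, divided by \<open>Suc N\<close>.\<close>

lemma sum_alternating_binomial_over:
  "(\<Sum>k=1..N. (-1) ^ k * of_nat (N choose k) / of_nat k) = - (harm N :: 'a::real_normed_field)"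
proof (induction N)
  case (Suc N)
  have "(\<Sum>k=1..Suc N. (-1) ^ k * of_nat (Suc N choose k) / of_nat k :: 'a) - (\<Sum>k=1..Suc N. (-1) ^ k * of_nat (N choose k) / of_nat k)
      = (\<Sum>k=1..Suc N. (-1) ^ k * of_nat (Suc N choose k) / of_nat (Suc N))"
    unfolding sum_subtractf[symmetric]
  proof (rule sum.cong)
    fix k assume "k \<in> {1..Suc N}"
    then obtain j where k: "k = Suc j" by (cases k) auto
    have "of_nat (Suc N) * of_nat (N choose j) = (of_nat k * of_nat (Suc N choose k) :: 'a)"
      unfolding k of_nat_mult[symmetric] Suc_times_binomial_eq by (simp add: mult.commute)
    hence e: "of_nat (N choose j) / of_nat k = (of_nat (Suc N choose k) / of_nat (Suc N) :: 'a)"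
      unfolding k by (simp add: field_simps del: of_nat_Suc binomial_Suc_Suc)
    have "(-1) ^ k * of_nat (Suc N choose k) / of_nat k - (-1) ^ k * of_nat (N choose k) / of_nat k
        = (-1) ^ k * (of_nat (N choose j) / of_nat k :: 'a)"
      unfolding k diff_divide_distrib[symmetric] by (simp add: algebra_simps del: of_nat_Suc)
    thus "(-1) ^ k * of_nat (Suc N choose k) / of_nat k - (-1) ^ k * of_nat (N choose k) / of_nat k
        = (-1) ^ k * of_nat (Suc N choose k) / (of_nat (Suc N) :: 'a)" unfolding e by simp
  qed simp
  also have "\<dots> = (\<Sum>k=1..Suc N. (-1) ^ k * of_nat (Suc N choose k)) / of_nat (Suc N)"
    by (rule sum_divide_distrib[symmetric])
  also have "(\<Sum>k=1..Suc N. (-1) ^ k * of_nat (Suc N choose k) :: 'a) = -1"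
  proof -
    have "0 = (\<Sum>k\<le>Suc N. (-1) ^ k * of_nat (Suc N choose k) :: 'a)"
      by (rule choose_alternating_sum[symmetric]) simp
    also have "{..Suc N} = insert 0 {1..Suc N}" by auto
    also have "(\<Sum>k\<in>\<dots>. (-1) ^ k * of_nat (Suc N choose k) :: 'a) = 1 + (\<Sum>k=1..Suc N. (-1) ^ k * of_nat (Suc N choose k))"
      by (subst sum.insert) auto
    finally show ?thesis by (simp add: eq_neg_iff_add_eq_0 add.commute)
  qed
  \<comment> \<open>The top term vanishes because \<open>N choose Suc N\<close> is 0.\<close>
  also have "(\<Sum>k=1..Suc N. (-1) ^ k * of_nat (N choose k) / of_nat k) = - (harm N :: 'a)"
    using Suc by (simp del: of_nat_Suc)
  finally show ?case by (simp add: harm_Suc field_simps)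
qed (simp add: harm_def)

subsection \<open>The closed form\<close>

text \<open>With \<open>z = a + k\<close> the rational factor is a constant times
  \<open>1 / (z * pochhammer z (N + 1))\<close>. Expanding \<open>1 / pochhammer z (N + 1)\<close>
  by \<open>fact_over_pochhammer\<close>, the summand \<open>j = 0\<close> yields the double pole,
  and each \<open>j > 0\<close> a product \<open>1 / (z * (z + j))\<close> that splits
  again.\<close>

lemma hyp_term_partial_fractions:
  assumes "a \<notin> \<int>\<^sub>\<le>\<^sub>0"
  shows "hyp_term a a x (1 + a) (1 + a + of_nat N) k = a * pochhammer a (N + 1) / fact N *
    (pochhammer x k / fact k / (a + of_nat k)\<^sup>2 +
      (\<Sum>j=1..N. pochhammer (- of_nat N) j / fact j / of_nat j *
        (pochhammer x k / fact k / (a + of_nat k) - pochhammer x k / fact k / (a + of_nat j + of_nat k))))"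
proof -
  define z where "z = a + of_nat k"
  define c where "c = pochhammer x k / fact k"
  define q :: "nat \<Rightarrow> complex" where "q j = pochhammer (- of_nat N) j / fact j" for j
  have z: "z \<notin> \<int>\<^sub>\<le>\<^sub>0" unfolding z_def by (intro not_nonpos_Int_add_nat assms)
  have zj: "z + of_nat j \<noteq> 0" for j using z plus_of_nat_eq_0_imp by blast
  have z0: "z \<noteq> 0" using zj[of 0] by simp
  \<comment> \<open>Both sides are \<open>pochhammer a (N + 1 + k)\<close>.\<close>
  have "pochhammer a k * pochhammer z (N + 1) = pochhammer a (N + 1) * pochhammer (1 + a + of_nat N) k"
    using pochhammer_product'[of a k "N + 1"] pochhammer_product'[of a "N + 1" k]
    by (simp add: z_def add_ac)
  moreover have "pochhammer z (N + 1) \<noteq> 0" "pochhammer (1 + a + of_nat N) k \<noteq> 0"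
    using z not_nonpos_Int_add_nat[OF assms, of "N + 1"]
    by (auto dest!: pochhammer_eq_0_imp_nonpos_Int simp: add_ac)
  ultimately have 2: "pochhammer a k / pochhammer (1 + a + of_nat N) k = pochhammer a (N + 1) / pochhammer z (N + 1)"
    by (simp add: frac_eq_eq)
  have "1 / pochhammer z (N + 1) = (fact N / pochhammer z (N + 1)) / fact N" by simp
  also have "\<dots> = (\<Sum>j\<le>N. q j / (z + of_nat j)) / fact N"
    unfolding fact_over_pochhammer[OF z] q_def ..
  finally have 3: "1 / pochhammer z (N + 1) = (\<Sum>j\<le>N. q j / (z + of_nat j)) / fact N" .
  have 4: "1 / z * (\<Sum>j\<le>N. q j / (z + of_nat j)) =
      1 / z\<^sup>2 + (\<Sum>j=1..N. q j / of_nat j * (1 / z - 1 / (z + of_nat j)))"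
  proof -
    have "{..N} = insert 0 {1..N}" by auto
    hence "(\<Sum>j\<le>N. q j / (z + of_nat j)) = 1 / z + (\<Sum>j=1..N. q j / (z + of_nat j))"
      by (simp add: q_def)
    moreover have "1 / z * (\<Sum>j=1..N. q j / (z + of_nat j)) = (\<Sum>j=1..N. q j / of_nat j * (1 / z - 1 / (z + of_nat j)))"
      unfolding sum_distrib_left
    proof (rule sum.cong)
      fix j assume "j \<in> {1..N}"
      hence "1 / z * (1 / (z + of_nat j)) = 1 / of_nat j * (1 / z - 1 / (z + of_nat j))"
        using z0 zj[of j] by (simp add: divide_simps)
      hence "q j * (1 / z * (1 / (z + of_nat j))) = q j * (1 / of_nat j * (1 / z - 1 / (z + of_nat j)))"
        by (simp only:)
      thus "1 / z * (q j / (z + of_nat j)) = q j / of_nat j * (1 / z - 1 / (z + of_nat j))" by simp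
    qed simp
    ultimately show ?thesis by (simp add: distrib_left power2_eq_square)
  qed
  have "hyp_term a a x (1 + a) (1 + a + of_nat N) k =
      c * (pochhammer a k / pochhammer (a + 1) k) * (pochhammer a k / pochhammer (1 + a + of_nat N) k)"
    unfolding hyp_term_def c_def times_divide_times_eq by (simp only: mult_ac add_ac)
  also have "\<dots> = c * (a / z) * (pochhammer a (N + 1) * (1 / pochhammer z (N + 1)))"
    unfolding pochhammer_shift_quotient[OF assms] 2 z_def by simp
  also have "\<dots> = a * pochhammer a (N + 1) / fact N * (c * (1 / z * (\<Sum>j\<le>N. q j / (z + of_nat j))))"
    unfolding 3 by (simp add: mult_ac)
  also have "c * (1 / z * (\<Sum>j\<le>N. q j / (z + of_nat j))) =
      c / z\<^sup>2 + (\<Sum>j=1..N. q j / of_nat j * (c / z - c / (a + of_nat j + of_nat k)))"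
    unfolding 4 unfolding distrib_left sum_distrib_left by (intro arg_cong2[of _ _ _ _ "(+)"] sum.cong)
      (simp_all add: z_def add_ac right_diff_distrib mult_ac)
  finally show ?thesis by (simp only: z_def c_def q_def)
qed

text \<open>For \<open>Re x < 1\<close> each partial fraction is summable by itself. The shifted
  beta values are multiples of \<open>Beta a (1 - x)\<close> and produce the finite sum of the
  closed form; the unshifted ones produce \<open>- harm N\<close>, hence the terms in
  \<open>Digamma (N + 1)\<close> and \<open>euler_mascheroni\<close>.\<close>

lemma sums_closed_form:
  assumes "a \<notin> \<int>\<^sub>\<le>\<^sub>0" "a - x + 1 \<notin> \<int>\<^sub>\<le>\<^sub>0" "Re x < 1"
  shows "hyp_term a a x (1 + a) (1 + a + of_nat N) sums closed_form N a x"
proof -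
  define q :: "nat \<Rightarrow> complex" where "q j = pochhammer (- of_nat N) j / fact j" for j
  define B where "B = Beta a (1 - x)"
  define P where "P = a * pochhammer a (N + 1) / fact N"
  define A where "A = a * Gamma (a + of_nat N + 1) * Gamma (1 - x) / (fact N * Gamma (a - x + 1))"
  have G: "Gamma a \<noteq> 0" "Gamma (a - x + 1) \<noteq> 0" using assms by (auto simp: Gamma_eq_zero_iff)
  have Bj: "Beta (a + of_nat j) (1 - x) = B * (pochhammer a j / pochhammer (a - x + 1) j)" for j
    using G unfolding Beta_def B_def pochhammer_Gamma[OF assms(1)] pochhammer_Gamma[OF assms(2)]
    by (simp add: algebra_simps)
  have PB: "P * B = A"
    using G unfolding Beta_def B_def A_def P_def pochhammer_Gamma[OF assms(1)] by (simp add: algebra_simps)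
  have "hyp_term a a x (1 + a) (1 + a + of_nat N) sums (P *
      (B * (Digamma (a - x + 1) - Digamma a) +
        (\<Sum>j=1..N. q j / of_nat j * (B - Beta (a + of_nat j) (1 - x)))))"
    unfolding hyp_term_partial_fractions[OF assms(1)] q_def B_def P_def using assms
    by (intro sums_mult sums_add sums_sum sums_diff sums_Beta sums_Beta_deriv not_nonpos_Int_add_nat)
  also have "(\<Sum>j=1..N. q j / of_nat j * (B - Beta (a + of_nat j) (1 - x))) =
      B * ((\<Sum>j=1..N. q j / of_nat j) - (\<Sum>j=1..N. q j / of_nat j * (pochhammer a j / pochhammer (a - x + 1) j)))"
    unfolding Bj sum_subtractf[symmetric] sum_distrib_left by (intro sum.cong) (simp_all add: algebra_simps)
  also have "(\<Sum>j=1..N. q j / of_nat j) = - harm N"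
    unfolding q_def pochhammer_minus_over_fact by (rule sum_alternating_binomial_over)
  also have "- harm N = - Digamma (of_nat N + 1) - (euler_mascheroni :: complex)"
    using Digamma_of_nat[of N, where ?'a = complex] by (simp add: add_ac)
  also have "(\<Sum>j=1..N. q j / of_nat j * (pochhammer a j / pochhammer (a - x + 1) j)) =
      (\<Sum>k=1..N. pochhammer a k * pochhammer (- of_nat N) k / (of_nat k * fact k * pochhammer (a - x + 1) k))"
    unfolding q_def by (intro sum.cong) (simp_all add: mult_ac)
  also have "P *
      (B * (Digamma (a - x + 1) - Digamma a) +
        B * (- Digamma (of_nat N + 1) - euler_mascheroni -
          (\<Sum>k=1..N. pochhammer a k * pochhammer (- of_nat N) k / (of_nat k * fact k * pochhammer (a - x + 1) k)))) =
      closed_form N a x"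
    unfolding closed_form_def A_def[symmetric] unfolding PB[symmetric] by (simp add: algebra_simps)
  finally show ?thesis .
qed

section \<open>Analytic continuation in \<open>x\<close>\<close>

lemma not_real_not_nonpos_Int: "Im z \<noteq> 0 \<Longrightarrow> z \<notin> \<int>\<^sub>\<le>\<^sub>0"
  by (auto elim!: nonpos_Ints_cases')

lemma closed_form_holomorphic:
  assumes "\<And>x. x \<in> S \<Longrightarrow> 1 - x \<notin> \<int>\<^sub>\<le>\<^sub>0" "\<And>x. x \<in> S \<Longrightarrow> a - x + 1 \<notin> \<int>\<^sub>\<le>\<^sub>0"
  shows "closed_form N a holomorphic_on S"
proof -
  have dig: "(\<lambda>x. Digamma (a - x + 1)) holomorphic_on S"
    using holomorphic_on_compose[of "\<lambda>x. a - x + 1" S "Polygamma 0"] assms(2)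
    by (force simp: o_def intro!: holomorphic_intros)
  have nz: "pochhammer (a - x + 1) k \<noteq> 0" "Gamma (a - x + 1) \<noteq> 0" if "x \<in> S" for x k
    using assms(2)[OF that] pochhammer_eq_0_imp_nonpos_Int by (auto simp: Gamma_eq_zero_iff)
  have poch: "(\<lambda>x. pochhammer (a - x + 1) k) holomorphic_on S" for k
    unfolding pochhammer_prod by (intro holomorphic_intros)
  show ?thesis unfolding closed_form_def using assms nz
    by (intro holomorphic_intros dig poch) auto
qed

text \<open>The identity theorem in \<open>x\<close> for fixed \<open>a\<close>, starting from
  \<open>Re x < 1\<close>. The poles \<open>E\<close> form a countable closed set, so the half-plane
  minus \<open>E\<close> is open and connected.\<close>

lemma suminf_eq_closed_form:
  assumes "(a, x) \<in> regular_points N"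
  shows "(\<Sum>k. hyp_term a a x (1 + a) (1 + a + of_nat N) k) = closed_form N a x"
proof -
  define E where "E = {y. 1 - y \<in> \<int>\<^sub>\<le>\<^sub>0} \<union> {y. a - y + 1 \<in> \<int>\<^sub>\<le>\<^sub>0}"
  define H where "H = {y. Re y < real N + 2}"
  have a: "a \<notin> \<int>\<^sub>\<le>\<^sub>0" and x: "x \<in> H - E"
    using assms by (auto simp: regular_points_def parameter_range_def H_def E_def)
  have an: "1 + a \<notin> \<int>\<^sub>\<le>\<^sub>0" "1 + a + of_nat N \<notin> \<int>\<^sub>\<le>\<^sub>0"
    using not_nonpos_Int_add_nat[OF a, of 1] not_nonpos_Int_add_nat[OF a, of "N + 1"]
    by (simp_all add: add_ac)
  have "countable (\<int>\<^sub>\<le>\<^sub>0 :: complex set)"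
    by (rule countable_subset[OF nonpos_Ints_subset_Ints]) (simp add: Ints_def)
  moreover have "E \<subseteq> (\<lambda>z. 1 - z) ` \<int>\<^sub>\<le>\<^sub>0 \<union> (\<lambda>z. a + 1 - z) ` \<int>\<^sub>\<le>\<^sub>0"
    unfolding E_def by (force simp: image_iff algebra_simps)
  ultimately have "countable E" by (meson countable_Un countable_image countable_subset)
  have "closed E"
  proof -
    have "closed ((\<lambda>y. 1 - y) -` \<int>\<^sub>\<le>\<^sub>0 \<union> (\<lambda>y. a - y + 1) -` \<int>\<^sub>\<le>\<^sub>0)"
      by (intro closed_Un closed_vimage closed_nonpos_Ints continuous_intros)
    thus ?thesis by (simp add: E_def vimage_def)
  qed
  have "open H" "convex H"
    unfolding H_def by (rule open_halfspace_Re_lt, rule convex_halfspace_Re_lt)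
  have "connected (H - E)"
    using \<open>open H\<close> \<open>convex H\<close> \<open>countable E\<close> by (intro connected_open_diff_countable convex_connected) auto
  have "open (H - E)" using \<open>open H\<close> \<open>closed E\<close> by (rule open_Diff)
  have hol: "(\<lambda>y. \<Sum>k. hyp_term a a y (1 + a) (1 + a + of_nat N) k) holomorphic_on (H - E)"
    using an by (intro holomorphic_on_hyp_suminf \<open>open (H - E)\<close>) (auto simp: H_def)
  \<comment> \<open>A point with real part 0 for which neither \<open>1 - w\<close> nor
    \<open>a - w + 1\<close> is real, so it lies outside \<open>E\<close>.\<close>
  define w where "w = \<i> * of_real (\<bar>Im a\<bar> + 1)"
  have w: "Re w = 0" "Im w \<noteq> 0" "Im w \<noteq> Im a" by (auto simp: w_def)
  hence "1 - w \<notin> \<int>\<^sub>\<le>\<^sub>0" "a - w + 1 \<notin> \<int>\<^sub>\<le>\<^sub>0" by (auto intro!: not_real_not_nonpos_Int)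
  hence "w \<in> (H - E) \<inter> {y. Re y < 1}" using w(1) by (simp add: H_def E_def)
  hence ne: "(H - E) \<inter> {y. Re y < 1} \<noteq> {}" by blast
  show ?thesis
  proof (rule analytic_continuation_open[OF _ \<open>open (H - E)\<close> ne \<open>connected (H - E)\<close> _ hol _ _ x])
    show "open ((H - E) \<inter> {y. Re y < 1})"
      by (intro open_Int \<open>open (H - E)\<close> open_halfspace_Re_lt)
    show "closed_form N a holomorphic_on H - E"
      by (rule closed_form_holomorphic) (auto simp: E_def)
    show "(\<Sum>k. hyp_term a a z (1 + a) (1 + a + of_nat N) k) = closed_form N a z"
      if "z \<in> (H - E) \<inter> {y. Re y < 1}" for z
      using that a by (intro sums_unique[symmetric] sums_closed_form) (auto simp: E_def)
  qed auto
qed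

section \<open>Continuous extension to the whole parameter range\<close>

text \<open>Uniqueness of limits, and with it the meaning of \<open>Lim\<close> in
  \<open>closed_form_ext\<close>, depends on this.\<close>

lemma at_within_regular_points_nontrivial:
  assumes "(a, x) \<in> parameter_range N"
  shows "at (a, x) within regular_points N \<noteq> bot"
proof -
  \<comment> \<open>Vertical moves preserve the real parts. The different speeds 1 and 2 make the
    imaginary parts of \<open>a\<close>, \<open>1 - x\<close> and \<open>a - x + 1\<close> all vary,
    so each is zero for only one \<open>t\<close>.\<close>
  define g where "g t = (a + \<i> * of_real t, x + \<i> * of_real (2 * t))" for t :: real
  have "eventually (\<lambda>t. t \<noteq> r) (at_right (0::real))" for r
  proof (cases "r > 0")
    case True
    hence "eventually (\<lambda>t. t \<in> {0<..<r}) (at_right (0::real))" by (rule eventually_at_right_real)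
    thus ?thesis by eventually_elim auto
  next
    case False
    show ?thesis using eventually_at_right_less[of 0] by eventually_elim (use False in auto)
  qed
  hence ev: "eventually (\<lambda>t. t > 0 \<and> t \<noteq> - Im a \<and> t \<noteq> - Im x / 2 \<and> t \<noteq> Im a - Im x) (at_right (0::real))"
    by (intro eventually_conj eventually_at_right_less)
  have "eventually (\<lambda>t. g t \<in> regular_points N - {(a, x)}) (at_right 0)"
    using ev
  proof eventually_elim
    case (elim t)
    have im: "Im (a + \<i> * of_real t) \<noteq> 0" "Im (1 - (x + \<i> * of_real (2 * t))) \<noteq> 0"
      "Im (a + \<i> * of_real t - (x + \<i> * of_real (2 * t)) + 1) \<noteq> 0"
      using elim by auto
    have "a + \<i> * of_real t \<noteq> - of_nat n" for n using im(1) by (auto simp: complex_eq_iff)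
    thus ?case using elim assms im[THEN not_real_not_nonpos_Int]
      by (simp add: g_def regular_points_def parameter_range_def)
  qed
  moreover have "(g \<longlongrightarrow> (a + \<i> * of_real 0, x + \<i> * of_real (2 * 0))) (at_right 0)"
    unfolding g_def by (intro tendsto_intros)
  ultimately have "filterlim g (at (a, x) within regular_points N) (at_right 0)"
    by (simp add: filterlim_at eventually_conj_iff)
  thus ?thesis by (auto simp: filterlim_def bot_unique filtermap_bot_iff)
qed

text \<open>Convergence and existence of the limit are asserted separately because
  \<open>suminf\<close> and \<open>Lim\<close> have arbitrary values otherwise; the continuity
  clause says that \<open>closed_form_ext\<close> is the continuous extension.\<close>

theorem theorem1:
  fixes N :: nat and a x :: complex
  assumes "\<forall>n::nat. n > 0 \<longrightarrow> a \<noteq> - of_nat n"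
    and "Re x < real N + 2"
  shows "hypergeometric_converges [a, a, x] [1 + a, 1 + a + of_nat N] 1
    \<and> ((\<lambda>(b, y). closed_form N b y) \<longlongrightarrow> closed_form_ext N a x)
          (at (a, x) within regular_points N)
    \<and> continuous_on (parameter_range N) (\<lambda>(b, y). closed_form_ext N b y)
    \<and> hypergeometric [a, a, x] [1 + a, 1 + a + of_nat N] 1 = closed_form_ext N a x"
proof -
  \<comment> \<open>The sum of the series as a function of the pair: continuous on the range and
    equal to the closed form at regular points, it must be the extension.\<close>
  define F where "F = (\<lambda>p. \<Sum>k. hyp_term (fst p) (fst p) (snd p) (1 + fst p) (1 + fst p + of_nat N) k)"
  have nz: "1 + b + of_nat m \<notin> \<int>\<^sub>\<le>\<^sub>0" if "(b, y) \<in> parameter_range N" for b y m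
  proof
    assume "1 + b + of_nat m \<in> \<int>\<^sub>\<le>\<^sub>0"
    then obtain n where "1 + b + of_nat m = - of_nat n" by (elim nonpos_Ints_cases')
    hence "b = - of_nat (n + m + 1)" by (simp add: algebra_simps eq_neg_iff_add_eq_0)
    thus False using that unfolding parameter_range_def by auto
  qed
  have "open (parameter_range N)"
  proof -
    \<comment> \<open>That \<open>a\<close> is not a negative integer means that
      \<open>1 + a\<close> avoids the closed set of non-positive integers.\<close>
    have "parameter_range N = (\<lambda>p. 1 + fst p) -` (- \<int>\<^sub>\<le>\<^sub>0) \<inter> (\<lambda>p. Re (snd p)) -` {..<real N + 2}"
    proof (intro set_eqI iffI)
      fix p :: "complex \<times> complex"
      assume "p \<in> (\<lambda>p. 1 + fst p) -` (- \<int>\<^sub>\<le>\<^sub>0) \<inter> (\<lambda>p. Re (snd p)) -` {..<real N + 2}"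
      moreover have "1 + - of_nat n \<in> (\<int>\<^sub>\<le>\<^sub>0 :: complex set)" if "n > 0" for n
        using that by (cases n) auto
      ultimately show "p \<in> parameter_range N" by (cases p) (auto simp: parameter_range_def)
    qed (use nz[of _ _ 0] in \<open>auto simp: parameter_range_def\<close>)
    also have "open \<dots>"
      by (intro open_Int open_vimage) (auto intro!: continuous_intros)
    finally show ?thesis .
  qed
  have cont: "continuous_on (parameter_range N) F"
    unfolding F_def using nz[of _ _ 0] nz
    by (intro continuous_on_hyp_suminf \<open>open (parameter_range N)\<close> continuous_intros)
       (auto simp: parameter_range_def)
  have reg: "F p = (case p of (b, y) \<Rightarrow> closed_form N b y)" if "p \<in> regular_points N" for p
    using that suminf_eq_closed_form[of "fst p" "snd p" N] by (auto simp: F_def case_prod_beta)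
  have lim: "((\<lambda>(b, y). closed_form N b y) \<longlongrightarrow> F (b, y)) (at (b, y) within regular_points N)"
    if "(b, y) \<in> parameter_range N" for b y
  proof -
    have "(F \<longlongrightarrow> F (b, y)) (at (b, y) within parameter_range N)"
      using cont that by (simp add: continuous_on_def)
    hence "(F \<longlongrightarrow> F (b, y)) (at (b, y) within regular_points N)"
      by (rule tendsto_within_subset) (auto simp: regular_points_def)
    moreover have "\<forall>\<^sub>F p in at (b, y) within regular_points N. F p = (case p of (b, y) \<Rightarrow> closed_form N b y)"
      using reg by (auto simp: eventually_at_filter)
    ultimately show ?thesis by (rule Lim_transform_eventually)
  qed
  \<comment> \<open>At regular points this is the summation formula; elsewhere \<open>Lim\<close>
    returns the limit just found, which is unique.\<close>
  have ext: "closed_form_ext N b y = F (b, y)" if "(b, y) \<in> parameter_range N" for b y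
    using reg[of "(b, y)"] tendsto_Lim[OF at_within_regular_points_nontrivial[OF that] lim[OF that]]
    by (simp add: closed_form_ext_def)
  have ax: "(a, x) \<in> parameter_range N" using assms by (simp add: parameter_range_def)
  have hyp: "(\<Prod>a\<leftarrow>[a, a, x]. pochhammer a k) / (fact k * (\<Prod>b\<leftarrow>[1 + a, 1 + a + of_nat N]. pochhammer b k)) * 1 ^ k
      = hyp_term a a x (1 + a) (1 + a + of_nat N) k" for k
    by (simp add: hyp_term_def mult_ac)
  have "hypergeometric [a, a, x] [1 + a, 1 + a + of_nat N] 1 = F (a, x)"
    unfolding hypergeometric_eq_suminf hyp F_def by simp
  moreover have "hypergeometric_converges [a, a, x] [1 + a, 1 + a + of_nat N] 1"
  proof -
    have "summable (hyp_term a a x (1 + a) (1 + a + of_nat N))"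
      using assms(2) by (intro summable_hyp_term) simp
    also have "hyp_term a a x (1 + a) (1 + a + of_nat N) =
        (\<lambda>k. fps_nth (fps_hypergeo [a, a, x] [1 + a, 1 + a + of_nat N] 1) k * 1 ^ k)"
      by (simp add: hyp_term_def fun_eq_iff mult_ac)
    finally show ?thesis unfolding hypergeometric_converges_def .
  qed
  moreover have "continuous_on (parameter_range N) (\<lambda>(b, y). closed_form_ext N b y)"
    using cont by (rule continuous_on_eq) (auto simp: ext)
  ultimately show ?thesis using lim[OF ax] ext[OF ax] by simp
qed

end
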